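(* The classes $\mathtt{HCEGIS}$ and $\mathtt{CEGIS}$ are incomparable: $\mathtt{HCEGIS}\not\subseteq\mathtt{CEGIS}$ and $\mathtt{CEGIS}\not\subseteq\mathtt{HCEGIS}$ (in particular $\mathtt{HCEGIS}\neq\mathtt{CEGIS}$). Here $\mathtt{CEGIS}$ (resp. $\mathtt{HCEGIS}$) denotes the class of indexed families of languages $\mathscr{L}$ for which there exists a CEGIS engine (resp. HCEGIS engine) that identifies $\mathscr{L}$.
   Context: Languages are subsets of $\mathbb{N}$, ordered by the natural order of $\mathbb{N}$; $\overline{L}=\mathbb{N}\setminus L$. An indexed family of languages is a sequence $\mathscr{L}=L_0,L_1,\ldots$ of non-empty recursive languages for which there is a total recursive function $\mathtt{TEMPLATE}$ with $\mathtt{TEMPLATE}(i,n)=1$ if $n\in L_i$ and $0$ otherwise; the program $P_i$ is $n\mapsto\mathtt{TEMPLATE}(i,n)$, $\mathscr{P}=\{P_0,P_1,\ldots\}$, and $L(P_i)=L_i$. A sequence is a map $\sigma:\mathbb{N}\to\mathbb{N}\cup\{\bot\}$; $\sigma[k]$ is its prefix of length $k$, $\sigma(k)$ its $k$-th element, $\sigma_0$ the empty sequence, $\mathtt{SMPL}(\sigma)=\mathrm{range}(\sigma)\setminus\{\bot\}$. A trace for $L$ is a sequence $\tau$ with $\mathtt{SMPL}(\tau)=L$. A verifier $\mathtt{CHECK}_L$ is a (non-deterministic) map from $\mathscr{L}$ to $\mathbb{N}\cup\{\bot\}$ with $\mathtt{CHECK}_L(L_i)=\bot$ iff $L_i\subseteq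 L$ and otherwise $\mathtt{CHECK}_L(L_i)\in L_i\cap\overline{L}$. A history-bounded verifier $\mathtt{HCHECK}_L$ maps a language $L_i\in\mathscr{L}$ and a trace prefix $\tau[n]$ to $\mathbb{N}\cup\{\bot\}$: $\mathtt{HCHECK}_L(L_i,\tau[n])=m$ for some $m\in\overline{L}\cap L_i$ with $m<\tau(j)$ for some $j\le n$, if such $m$ exists, and $\mathtt{HCHECK}_L(L_i,\tau[n])=\bot$ otherwise. A CEGIS engine is given by a recursive $F:\mathscr{P}\times\mathbb{N}\times\mathbb{N}\to\mathscr{P}$ (counterexample argument may be $\bot$) and initial program $P_0$: $T(\sigma_0,\sigma_0)=P_0$, $T(\tau[n],\mathtt{cex}[n])=F(T(\tau[n-1],\mathtt{cex}[n-1]),\tau(n),\mathtt{cex}(n))$, where $\tau$ is a trace of the target language $L$ and $\mathtt{cex}(i)=\mathtt{CHECK}_L(L(T(\tau[i-1],\mathtt{cex}[i-1])))$. An HCEGIS engine is defined identically but with $\mathtt{cex}(i)=\mathtt{HCHECK}_L(L(T(\tau[i-1],\mathtt{cex}[i-1])),\tau[i-1])$. $T$ converges to $P_i$ on $(\tau,\mathtt{cex})$ if $T(\tau[n],\mathtt{cex}[n])=P_i$ for all sufficiently large $n$; $T$ identifies $L_i$ if it converges to $P_i$ for every trace $\tau$ of $L_i$ and every corresponding counterexample sequence; $T$ identifies $\mathscr{L}$ if it identifies every member. *)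

theory Defs
  imports Main
begin

datatype recf = Zr | Sc | Proj nat | Comp recf "recf list" | Prim recf recf | Mn recf

inductive reval :: "recf \<Rightarrow> nat list \<Rightarrow> nat \<Rightarrow> bool" where
  zero: "reval Zr xs 0"
| succ: "reval Sc (x # xs) (Suc x)"
| proj: "i < length xs \<Longrightarrow> reval (Proj i) xs (xs ! i)"
| comp: "length ys = length gs \<Longrightarrow> (\<forall>k < length gs. reval (gs ! k) xs (ys ! k))
          \<Longrightarrow> reval f ys z \<Longrightarrow> reval (Comp f gs) xs z"
| prim0: "reval f xs y \<Longrightarrow> reval (Prim f g) (0 # xs) y"
| primS: "reval (Prim f g) (n # xs) y \<Longrightarrow> reval g (y # n # xs) z
          \<Longrightarrow> reval (Prim f g) (Suc n # xs) z"
| mn: "reval f (n # xs) 0 \<Longrightarrow> (\<forall>k < n. \<exists>y. reval f (k # xs) (Suc y))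
          \<Longrightarrow> reval (Mn f) xs n"

definition total_recursive2 :: "(nat \<Rightarrow> nat \<Rightarrow> nat) \<Rightarrow> bool" where
  "total_recursive2 f \<longleftrightarrow> (\<exists>c. \<forall>x y. reval c [x, y] (f x y))"

definition total_recursive3 :: "(nat \<Rightarrow> nat \<Rightarrow> nat \<Rightarrow> nat) \<Rightarrow> bool" where
  "total_recursive3 f \<longleftrightarrow> (\<exists>c. \<forall>x y z. reval c [x, y, z] (f x y z))"

text \<open>Coding of \<open>\<nat> \<union> {\<bottom>}\<close> (as \<open>nat option\<close>, \<open>None\<close> = \<open>\<bottom>\<close>) into \<open>\<nat>\<close>.\<close>
fun dec_opt :: "nat \<Rightarrow> nat option" where
  "dec_opt 0 = None"
| "dec_opt (Suc m) = Some m"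

text \<open>A family is \<open>L :: nat \<Rightarrow> nat set\<close>; program \<open>P_i\<close> is represented by its index \<open>i\<close>,
  with \<open>L(P_i) = L i\<close>.\<close>
definition indexed_family :: "(nat \<Rightarrow> nat set) \<Rightarrow> bool" where
  "indexed_family L \<longleftrightarrow> (\<forall>i. L i \<noteq> {}) \<and>
     total_recursive2 (\<lambda>i n. if n \<in> L i then 1 else 0)"

definition SMPL :: "(nat \<Rightarrow> nat option) \<Rightarrow> nat set" where
  "SMPL \<sigma> = {x. \<exists>n. \<sigma> n = Some x}"

definition is_trace :: "(nat \<Rightarrow> nat option) \<Rightarrow> nat set \<Rightarrow> bool" where
  "is_trace \<tau> A \<longleftrightarrow> SMPL \<tau> = A"

text \<open>An engine: update map \<open>F\<close> on programs (indices), example and counterexample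
  arguments in \<open>\<nat> \<union> {\<bottom>}\<close>. It must be recursive, and a genuine map on the set of programs
  \<open>\<P>\<close>, i.e. it may only depend on the program \<open>P_p\<close> (a function, determined by \<open>L p\<close>).\<close>
definition engine :: "(nat \<Rightarrow> nat set) \<Rightarrow> (nat \<Rightarrow> nat option \<Rightarrow> nat option \<Rightarrow> nat) \<Rightarrow> bool" where
  "engine L F \<longleftrightarrow> total_recursive3 (\<lambda>p x c. F p (dec_opt x) (dec_opt c)) \<and>
     (\<forall>p p' x c. L p = L p' \<longrightarrow> L (F p x c) = L (F p' x c))"

text \<open>\<open>hyp F p0 \<tau> cex n\<close> = \<open>T(\<tau>[n], cex[n])\<close>; step \<open>n+1\<close> consumes \<open>\<tau> n\<close> and
  the counterexample \<open>cex n\<close> returned for the hypothesis \<open>hyp \<dots> n\<close>.\<close>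
fun hyp :: "(nat \<Rightarrow> nat option \<Rightarrow> nat option \<Rightarrow> nat) \<Rightarrow> nat \<Rightarrow> (nat \<Rightarrow> nat option)
             \<Rightarrow> (nat \<Rightarrow> nat option) \<Rightarrow> nat \<Rightarrow> nat" where
  "hyp F p0 \<tau> cex 0 = p0"
| "hyp F p0 \<tau> cex (Suc n) = F (hyp F p0 \<tau> cex n) (\<tau> n) (cex n)"

text \<open>Admissible answer \<open>c\<close> of a (nondeterministic) verifier \<open>CHECK_T\<close> on language \<open>H\<close>.\<close>
definition check_ok :: "nat set \<Rightarrow> nat set \<Rightarrow> nat option \<Rightarrow> bool" where
  "check_ok T H c \<longleftrightarrow> (H \<subseteq> T \<longrightarrow> c = None) \<and>
     (\<not> H \<subseteq> T \<longrightarrow> (\<exists>m. c = Some m \<and> m \<in> H \<and> m \<notin> T))"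

text \<open>Admissible answer of \<open>HCHECK_T(H, \<tau>[n])\<close>, where \<open>\<tau>[n] = \<tau> 0, \<dots>, \<tau> (n-1)\<close>.\<close>
definition hcheck_ok :: "nat set \<Rightarrow> nat set \<Rightarrow> (nat \<Rightarrow> nat option) \<Rightarrow> nat \<Rightarrow> nat option \<Rightarrow> bool" where
  "hcheck_ok T H \<tau> n c \<longleftrightarrow>
     (let S = {m. m \<in> H \<and> m \<notin> T \<and> (\<exists>j < n. \<exists>x. \<tau> j = Some x \<and> m < x)} in
       (S = {} \<longrightarrow> c = None) \<and> (S \<noteq> {} \<longrightarrow> (\<exists>m \<in> S. c = Some m)))"

definition cegis_identifies ::
  "(nat \<Rightarrow> nat set) \<Rightarrow> (nat \<Rightarrow> nat option \<Rightarrow> nat option \<Rightarrow> nat) \<Rightarrow> nat \<Rightarrow> nat \<Rightarrow> bool" where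
  "cegis_identifies L F p0 i \<longleftrightarrow>
     (\<forall>\<tau> cex. is_trace \<tau> (L i) \<longrightarrow>
        (\<forall>n. check_ok (L i) (L (hyp F p0 \<tau> cex n)) (cex n)) \<longrightarrow>
        (\<exists>N. \<forall>n \<ge> N. L (hyp F p0 \<tau> cex n) = L i))"

definition hcegis_identifies ::
  "(nat \<Rightarrow> nat set) \<Rightarrow> (nat \<Rightarrow> nat option \<Rightarrow> nat option \<Rightarrow> nat) \<Rightarrow> nat \<Rightarrow> nat \<Rightarrow> bool" where
  "hcegis_identifies L F p0 i \<longleftrightarrow>
     (\<forall>\<tau> cex. is_trace \<tau> (L i) \<longrightarrow>
        (\<forall>n. hcheck_ok (L i) (L (hyp F p0 \<tau> cex n)) \<tau> n (cex n)) \<longrightarrow>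
        (\<exists>N. \<forall>n \<ge> N. L (hyp F p0 \<tau> cex n) = L i))"

definition CEGIS :: "(nat \<Rightarrow> nat set) set" where
  "CEGIS = {L. indexed_family L \<and>
     (\<exists>F p0. engine L F \<and> (\<forall>i. cegis_identifies L F p0 i))}"

definition HCEGIS :: "(nat \<Rightarrow> nat set) set" where
  "HCEGIS = {L. indexed_family L \<and>
     (\<exists>F p0. engine L F \<and> (\<forall>i. hcegis_identifies L F p0 i))}"

end

theory Submission
  imports Defs "HOL-Library.Nat_Bijection"
begin

text \<open>
  For the first separating family take all initial segments of the naturals and the set of all
  naturals. A plain verifier reveals elements above the target, and jumping to the revealed bound
  descends to the target; a history-bounded verifier is silent because there are no gaps below shown
  elements, so a learner would have to identify the family from positive data alone.

  For the second one take \<open>B i\<close>, a tag \<open>i\<close> together with all body elements, and the finite languages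
  \<open>T(i,t,c,x)\<close>: the tag \<open>i\<close>, a mark \<open>t\<close>, the body elements below \<open>c\<close>, and one isolated body element
  \<open>x > c\<close>, the spike. Bounded counterexamples locate the first missing body element \<open>c\<close> exactly, whence
  an engine which only moves when refuted. A plain verifier may always answer with a wrong
  tag, with a wrong mark, or with a uselessly large body element. Against it, a learner that
  has arrived at \<open>B b\<close> has forgotten what it saw. If for infinitely many \<open>x\<close> it could arrive after
  seeing \<open>x\<close>, and also without, it could not tell \<open>T(b,t,m,m+1)\<close> from the languages
  \<open>T(b,t,m+2,x)\<close>: it has to settle on some language below both, and choosing \<open>x\<close> afterwards, different
  from all spikes conjectured so far, makes this settlement irrevocable. Hence from every play
  that has not yet arrived, the next element of \<open>B b\<close> can be shown, after a suitable far body
  element, without the learner arriving; in the limit it never identifies \<open>B b\<close>.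
\<close>

section \<open>Closure properties of the recursive functions\<close>

definition total_recursive1 :: "(nat \<Rightarrow> nat) \<Rightarrow> bool" where
  "total_recursive1 f \<longleftrightarrow> (\<exists>c. \<forall>x. reval c [x] (f x))"

lemma reval_Comp1:
  "reval g xs a \<Longrightarrow> reval f [a] z \<Longrightarrow> reval (Comp f [g]) xs z"
  by (rule reval.comp[where ys = "[a]"]) auto

lemma reval_Comp2:
  "reval g xs a \<Longrightarrow> reval h xs b \<Longrightarrow> reval f [a, b] z \<Longrightarrow> reval (Comp f [g, h]) xs z"
  by (rule reval.comp[where ys = "[a, b]"]) (auto simp: less_Suc_eq)

lemma reval_Comp3:
  "reval g xs a \<Longrightarrow> reval h xs b \<Longrightarrow> reval k xs d \<Longrightarrow> reval f [a, b, d] z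
    \<Longrightarrow> reval (Comp f [g, h, k]) xs z"
  by (rule reval.comp[where ys = "[a, b, d]"]) (auto simp: less_Suc_eq)

lemma reval_Proj: "i < length xs \<Longrightarrow> xs ! i = y \<Longrightarrow> reval (Proj i) xs y"
  using reval.proj by blast

lemma reval_Prim:
  assumes "reval f xs a" and "\<And>k y. reval g (y # k # xs) (h k y)"
  shows "reval (Prim f g) (n # xs) (rec_nat a h n)"
  using assms by (induction n) (auto intro: reval.prim0 reval.primS)

named_theorems recursive_intros

text \<open>Three variables serve as a common context: the closure rules keep this arity, so
  composite terms decompose from the outside in; smaller arities come from dummy arguments.\<close>

lemma recursive_fst [recursive_intros]: "total_recursive3 (\<lambda>x y z. x)"
  unfolding total_recursive3_def by (rule exI[of _ "Proj 0"]) (auto intro: reval_Proj)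

lemma recursive_snd [recursive_intros]: "total_recursive3 (\<lambda>x y z. y)"
  unfolding total_recursive3_def by (rule exI[of _ "Proj 1"]) (auto intro: reval_Proj)

lemma recursive_thd [recursive_intros]: "total_recursive3 (\<lambda>x y z. z)"
  unfolding total_recursive3_def by (rule exI[of _ "Proj 2"]) (auto intro: reval_Proj)

lemma recursive_comp1:
  assumes "total_recursive1 g" and "total_recursive3 f"
  shows "total_recursive3 (\<lambda>x y z. g (f x y z))"
  using assms unfolding total_recursive1_def total_recursive3_def by (meson reval_Comp1)

lemma recursive_comp2:
  assumes "total_recursive2 g" and "total_recursive3 f" and "total_recursive3 h"
  shows "total_recursive3 (\<lambda>x y z. g (f x y z) (h x y z))"
  using assms unfolding total_recursive2_def total_recursive3_def by (meson reval_Comp2)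

lemma recursive_comp3:
  assumes "total_recursive3 g" and "total_recursive3 f" and "total_recursive3 h"
    and "total_recursive3 k"
  shows "total_recursive3 (\<lambda>x y z. g (f x y z) (h x y z) (k x y z))"
  using assms unfolding total_recursive3_def by (meson reval_Comp3)

lemma total_recursive2I:
  assumes "total_recursive3 (\<lambda>x y z. f x y)"
  shows "total_recursive2 f"
proof -
  obtain c where "\<And>x y z. reval c [x, y, z] (f x y)"
    using assms by (auto simp: total_recursive3_def)
  then have "reval (Comp c [Proj 0, Proj 1, Zr]) [x, y] (f x y)" for x y
    by (intro reval_Comp3[of "Proj 0" _ x "Proj 1" y Zr 0]) (auto intro: reval_Proj reval.zero)
  then show ?thesis
    unfolding total_recursive2_def by blast
qed

lemma total_recursive1I:
  assumes "total_recursive3 (\<lambda>x y z. f x)"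
  shows "total_recursive1 f"
proof -
  obtain c where "\<And>x y z. reval c [x, y, z] (f x)"
    using assms by (auto simp: total_recursive3_def)
  then have "reval (Comp c [Proj 0, Zr, Zr]) [x] (f x)" for x
    by (intro reval_Comp3[of "Proj 0" _ x Zr 0 Zr 0]) (auto intro: reval_Proj reval.zero)
  then show ?thesis
    unfolding total_recursive1_def by blast
qed

lemma recursive_Suc [recursive_intros]:
  assumes "total_recursive3 f"
  shows "total_recursive3 (\<lambda>x y z. Suc (f x y z))"
proof -
  have "total_recursive1 Suc"
    unfolding total_recursive1_def using reval.succ by blast
  then show ?thesis
    using assms by (rule recursive_comp1)
qed

lemma recursive_zero [recursive_intros]: "total_recursive3 (\<lambda>x y z. 0)"
  unfolding total_recursive3_def using reval.zero by blast

lemma total_recursive2_rec_nat: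
  assumes "total_recursive1 f" and "total_recursive3 g"
  shows "total_recursive2 (\<lambda>n x. rec_nat (f x) (\<lambda>k y. g y k x) n)"
proof -
  obtain c d where "\<And>x. reval c [x] (f x)" and "\<And>x y z. reval d [x, y, z] (g x y z)"
    using assms by (auto simp: total_recursive1_def total_recursive3_def)
  then have "reval (Prim c d) [n, x] (rec_nat (f x) (\<lambda>k y. g y k x) n)" for n x
    by (intro reval_Prim)
  then show ?thesis
    unfolding total_recursive2_def by blast
qed

lemma recursive_rec_nat:
  assumes "total_recursive3 (\<lambda>y k x. g k y)" and "total_recursive3 f"
  shows "total_recursive3 (\<lambda>x y z. rec_nat 0 g (f x y z))"
proof (rule recursive_comp1[OF total_recursive1I assms(2)])
  have "total_recursive2 (\<lambda>n x. rec_nat 0 g n)"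
    using total_recursive2_rec_nat[OF total_recursive1I[OF recursive_zero] assms(1)] by simp
  from recursive_comp2[OF this recursive_fst recursive_fst]
  show "total_recursive3 (\<lambda>n y z. rec_nat 0 g n)" .
qed

lemma recursive_add [recursive_intros]:
  assumes "total_recursive3 f" and "total_recursive3 h"
  shows "total_recursive3 (\<lambda>x y z. f x y z + h x y z)"
proof (rule recursive_comp2[OF _ assms])
  have "rec_nat x (\<lambda>k y. Suc y) n = n + x" for n x :: nat
    by (induction n) auto
  then show "total_recursive2 (+)"
    using total_recursive2_rec_nat[of "\<lambda>x. x" "\<lambda>y k x. Suc y"]
    by (simp add: total_recursive1I recursive_intros)
qed

lemma recursive_diff [recursive_intros]:
  assumes "total_recursive3 f" and "total_recursive3 h"
  shows "total_recursive3 (\<lambda>x y z. f x y z - h x y z)"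
proof -
  have "rec_nat 0 (\<lambda>k y. k) n = n - 1" for n :: nat
    by (cases n) auto
  then have pred: "total_recursive3 (\<lambda>y k x. y - 1)"
    using recursive_rec_nat[of "\<lambda>k y. k" "\<lambda>y k x. y"] by (simp add: recursive_intros)
  have "rec_nat x (\<lambda>k y. y - 1) n = x - n" for n x :: nat
    by (induction n) auto
  then have "total_recursive2 (\<lambda>n x. x - n)"
    using total_recursive2_rec_nat[OF total_recursive1I[OF recursive_fst] pred] by simp
  from recursive_comp2[OF this assms(2,1)] show ?thesis .
qed

lemma recursive_if_zero:
  assumes "total_recursive3 a" and "total_recursive3 f" and "total_recursive3 h"
  shows "total_recursive3 (\<lambda>x y z. if a x y z = 0 then f x y z else h x y z)"
proof (rule recursive_comp3[OF _ assms])
  \<comment> \<open>A recursion whose step ignores the recursive value is a case distinction;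
    \<open>c\<close> is at position 3, behind that value, the counter and \<open>b\<close>.\<close>
  have "reval (Prim (Proj 0) (Proj 3)) [a, b, c] (rec_nat b (\<lambda>k y. c) a)" for a b c
    by (rule reval_Prim) (auto intro: reval_Proj)
  moreover have "rec_nat b (\<lambda>k y. c) a = (if a = 0 then b else c)" for a b c :: nat
    by (cases a) auto
  ultimately have "reval (Prim (Proj 0) (Proj 3)) [a, b, c] (if a = 0 then b else c)" for a b c
    by metis
  then show "total_recursive3 (\<lambda>a b c. if a = 0 then b else c)"
    unfolding total_recursive3_def by blast
qed

lemma recursive_if_eq [recursive_intros]:
  assumes "total_recursive3 a" and "total_recursive3 b"
    and "total_recursive3 f" and "total_recursive3 h"
  shows "total_recursive3 (\<lambda>x y z. if a x y z = b x y z then f x y z else h x y z)"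
proof -
  have "m = n \<longleftrightarrow> (m - n) + (n - m) = 0" for m n :: nat
    by auto
  then show ?thesis
    using recursive_if_zero[OF recursive_add[OF recursive_diff[OF assms(1,2)]
        recursive_diff[OF assms(2,1)]] assms(3,4)] by presburger
qed

lemma recursive_if_less [recursive_intros]:
  assumes "total_recursive3 a" and "total_recursive3 b"
    and "total_recursive3 f" and "total_recursive3 h"
  shows "total_recursive3 (\<lambda>x y z. if a x y z < b x y z then f x y z else h x y z)"
proof -
  have "(if m < n then u else v) = (if n - m = 0 then v else u)" for m n u v :: nat
    by auto
  then show ?thesis
    using recursive_if_zero[OF recursive_diff[OF assms(2,1)] assms(4,3)] by simp
qed

lemma recursive_one [recursive_intros]: "total_recursive3 (\<lambda>x y z. 1)"
  using recursive_Suc[OF recursive_zero] by simp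

lemma recursive_two [recursive_intros]: "total_recursive3 (\<lambda>x y z. 2)"
  using recursive_Suc[OF recursive_one] by (simp add: numeral_2_eq_2)

section \<open>Computability of the pairing function and its inverse\<close>

lemma recursive_triangle [recursive_intros]:
  assumes "total_recursive3 f"
  shows "total_recursive3 (\<lambda>x y z. triangle (f x y z))"
proof -
  have "triangle = rec_nat 0 (\<lambda>k y. y + Suc k)"
  proof
    show "triangle n = rec_nat 0 (\<lambda>k y. y + Suc k) n" for n
      by (induction n) auto
  qed
  then show ?thesis
    using recursive_rec_nat[OF _ assms, of "\<lambda>k y. y + Suc k"] by (simp add: recursive_intros)
qed

lemma recursive_prod_encode [recursive_intros]:
  assumes "total_recursive3 f" and "total_recursive3 h"
  shows "total_recursive3 (\<lambda>x y z. prod_encode (f x y z, h x y z))"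
  unfolding prod_encode_def using assms by (simp add: recursive_intros)

text \<open>The largest \<open>r\<close> with \<open>triangle r \<le> n\<close>. It is the sum of
  the two components of \<open>prod_decode n\<close>, which makes both projections
  recursive.\<close>

definition triangle_root :: "nat \<Rightarrow> nat" where
  "triangle_root = rec_nat 0 (\<lambda>k y. if Suc k < triangle (Suc y) then y else Suc y)"

lemma triangle_root_bounds:
  "triangle (triangle_root n) \<le> n \<and> n < triangle (Suc (triangle_root n))"
  by (induction n) (auto simp: triangle_root_def)

lemma recursive_triangle_root [recursive_intros]:
  assumes "total_recursive3 f"
  shows "total_recursive3 (\<lambda>x y z. triangle_root (f x y z))"
  unfolding triangle_root_def
  by (rule recursive_rec_nat[OF _ assms]) (intro recursive_intros)

definition proj1 :: "nat \<Rightarrow> nat" where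
  "proj1 n = fst (prod_decode n)"

definition proj2 :: "nat \<Rightarrow> nat" where
  "proj2 n = snd (prod_decode n)"

lemma proj_prod_encode [simp]: "proj1 (prod_encode (a, b)) = a" "proj2 (prod_encode (a, b)) = b"
  by (simp_all add: proj1_def proj2_def)

lemma prod_decode_triangle_root:
  "prod_decode n = (n - triangle (triangle_root n), triangle_root n - (n - triangle (triangle_root n)))"
proof -
  let ?r = "triangle_root n"
  have b: "triangle ?r \<le> n" "n < triangle (Suc ?r)"
    using triangle_root_bounds[of n] by auto
  then have "prod_encode (n - triangle ?r, ?r - (n - triangle ?r)) = n"
    by (simp add: prod_encode_def)
  then show ?thesis
    by (metis prod_encode_inverse)
qed

lemma recursive_proj1 [recursive_intros]:
  assumes "total_recursive3 f"
  shows "total_recursive3 (\<lambda>x y z. proj1 (f x y z))"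
  unfolding proj1_def prod_decode_triangle_root fst_conv using assms by (intro recursive_intros)

lemma recursive_proj2 [recursive_intros]:
  assumes "total_recursive3 f"
  shows "total_recursive3 (\<lambda>x y z. proj2 (f x y z))"
  unfolding proj2_def prod_decode_triangle_root snd_conv using assms by (intro recursive_intros)

section \<open>Initial segments\<close>

lemma eventually_constant_if_decreasing:
  fixes s :: "nat \<Rightarrow> nat" and \<Phi> :: "nat \<Rightarrow> nat"
  assumes stay: "\<And>n. s n = i \<Longrightarrow> s (Suc n) = i"
    and dec: "\<And>n. n \<ge> N \<Longrightarrow> s n \<noteq> i \<Longrightarrow> \<Phi> (s (Suc n)) < \<Phi> (s n)"
  shows "\<exists>N. \<forall>n\<ge>N. s n = i"
proof -
  have "\<exists>n. s n = i"
  proof (rule ccontr)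
    assume "\<nexists>n. s n = i"
    then have "\<Phi> (s (N + k)) + k \<le> \<Phi> (s N)" for k
    proof (induction k)
      case (Suc k)
      then show ?case using dec[of "N + k"] by force
    qed simp
    from this[of "Suc (\<Phi> (s N))"] show False by simp
  qed
  then obtain n where n: "s n = i" by blast
  have "s k = i" if "k \<ge> n" for k
    using that n by (induction k rule: dec_induct) (auto simp: stay)
  then show ?thesis by blast
qed

text \<open>Pairing makes every element recur arbitrarily late, so that fixed points of an engine
  can be read off after convergence.\<close>

lemma is_trace_proj1: "is_trace (\<lambda>n. if proj1 n \<in> A then Some (proj1 n) else None) A"
  unfolding is_trace_def SMPL_def by auto (metis proj_prod_encode(1))

text \<open>Index \<open>0\<close> would otherwise code the empty set, which an indexed family
  excludes; it is free to code all naturals.\<close>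

definition segment :: "nat \<Rightarrow> nat set" where
  "segment p = {n. p = 0 \<or> n < p}"

definition segment_step :: "nat \<Rightarrow> nat option \<Rightarrow> nat option \<Rightarrow> nat" where
  "segment_step p x c = (case c of None \<Rightarrow> p | Some m \<Rightarrow> m)"

lemma inj_segment: "segment p = segment p' \<Longrightarrow> p = p'"
proof (rule ccontr)
  assume eq: "segment p = segment p'" and "p \<noteq> p'"
  have "p \<in> segment p' \<longleftrightarrow> p = 0" "p' \<in> segment p \<longleftrightarrow> p' = 0"
    using eq by (auto simp: segment_def)
  with \<open>p \<noteq> p'\<close> show False by (auto simp: segment_def)
qed

lemma indexed_family_segment: "indexed_family segment"
proof -
  have "(\<lambda>i n. if n \<in> segment i then 1 else 0) =
      (\<lambda>i n. if i = 0 then 1 else if n < i then 1 else (0::nat))"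
    by (auto simp: segment_def fun_eq_iff)
  moreover have "total_recursive2 (\<lambda>i n. if i = 0 then 1 else if n < i then 1 else 0)"
    by (rule total_recursive2I) (intro recursive_intros)
  ultimately show ?thesis
    by (auto simp: indexed_family_def segment_def)
qed

lemma engine_injective_family:
  assumes "\<And>p p'. L p = L p' \<Longrightarrow> p = p'"
    and "total_recursive3 (\<lambda>p x c. F p (dec_opt x) (dec_opt c))"
  shows "engine L F"
  using assms unfolding engine_def by metis

text \<open>The first counterexample to the full set bounds the target from above, and each further
  one is a smaller bound, so the index sinks to \<open>i\<close> without overshooting.\<close>

lemma segment_step_identifies: "cegis_identifies segment segment_step 0 i"
  unfolding cegis_identifies_def
proof (intro allI impI)
  fix \<tau> cex
  define s where "s = hyp segment_step 0 \<tau> cex"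
  assume "\<forall>n. check_ok (segment i) (segment (hyp segment_step 0 \<tau> cex n)) (cex n)"
  then have ok: "check_ok (segment i) (segment (s n)) (cex n)" for n
    by (simp add: s_def)
  have s0: "s 0 = 0" and sS: "s (Suc n) = (case cex n of None \<Rightarrow> s n | Some m \<Rightarrow> m)" for n
    by (simp_all add: s_def segment_step_def split: option.split)
  have stay: "s (Suc n) = i" if "s n = i" for n
    using ok[of n] sS[of n] that by (simp add: check_ok_def)
  have kick: "\<exists>m. s (Suc n) = m \<and> m \<in> segment (s n) \<and> m \<notin> segment i"
    if "\<not> segment (s n) \<subseteq> segment i" for n
    using ok[of n] sS[of n] that by (auto simp: check_ok_def)
  have "\<exists>N. \<forall>n\<ge>N. s n = i"
  proof (cases "i = 0")
    case True
    then have "s n = i" for n using stay s0 by (induction n) auto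
    then show ?thesis by blast
  next
    case False
    have ge: "s n \<ge> i" if "n \<ge> 1" for n
      using that
    proof (induction n rule: dec_induct)
      case base
      have "\<not> segment (s 0) \<subseteq> segment i"
        using False s0 by (auto simp: segment_def)
      from kick[OF this] show ?case by (auto simp: segment_def)
    next
      case (step n)
      show ?case
      proof (cases "s n = i")
        case False
        then have "i \<in> segment (s n)" "i \<notin> segment i"
          using step \<open>i \<noteq> 0\<close> by (auto simp: segment_def)
        then have "\<not> segment (s n) \<subseteq> segment i" by blast
        from kick[OF this] show ?thesis by (auto simp: segment_def)
      qed (simp add: stay)
    qed
    have "s (Suc n) < s n" if "n \<ge> 1" "s n \<noteq> i" for n
    proof -
      have "i \<in> segment (s n)" "i \<notin> segment i"
        using ge[of n] that \<open>i \<noteq> 0\<close> by (auto simp: segment_def)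
      then have "\<not> segment (s n) \<subseteq> segment i" by blast
      from kick[OF this] show ?thesis using ge[of n] that \<open>i \<noteq> 0\<close> by (auto simp: segment_def)
    qed
    then show ?thesis
      using eventually_constant_if_decreasing[of s i 1 "\<lambda>p. p"] stay by blast
  qed
  then show "\<exists>N. \<forall>n\<ge>N. segment (hyp segment_step 0 \<tau> cex n) = segment i"
    by (auto simp: s_def)
qed

lemma segment_in_CEGIS: "segment \<in> CEGIS"
proof -
  have "segment_step p (dec_opt x) (dec_opt c) = (if c = 0 then p else c - 1)" for p x c
    by (cases c) (auto simp: segment_step_def)
  then have "total_recursive3 (\<lambda>p x c. segment_step p (dec_opt x) (dec_opt c))"
    by (simp only:) (intro recursive_intros)
  then show ?thesis
    unfolding CEGIS_def
    using indexed_family_segment segment_step_identifies engine_injective_family[OF inj_segment]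
    by blast
qed

text \<open>Initial segments have no gaps, so a history-bounded verifier never produces a
  counterexample.\<close>
lemma hcheck_ok_segment:
  assumes "is_trace \<tau> (segment i)"
  shows "hcheck_ok (segment i) (segment p) \<tau> n None"
proof -
  have "x \<in> segment i" if "\<tau> j = Some x" for j x
    using assms that by (auto simp: is_trace_def SMPL_def)
  then have "m \<in> segment i" if "\<tau> j = Some x" "m < x" for j x m
    using that by (fastforce simp: segment_def)
  then show ?thesis
    unfolding hcheck_ok_def Let_def by auto
qed

text \<open>A locking argument: every number is shown again after convergence on the full set, so no
  example moves the engine from \<open>0\<close>. Completing a converged prefix to a trace of a
  finite segment leaves it stuck there.\<close>

lemma segment_notin_HCEGIS: "segment \<notin> HCEGIS"
proof
  assume "segment \<in> HCEGIS"
  then obtain F p0 where ident: "\<And>i. hcegis_identifies segment F p0 i"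
    by (auto simp: HCEGIS_def)
  let ?s = "\<lambda>\<tau>. hyp F p0 \<tau> (\<lambda>_. None)"
  have conv: "\<exists>N. \<forall>n\<ge>N. ?s \<tau> n = i" if "is_trace \<tau> (segment i)" for \<tau> i
    using ident[of i] hcheck_ok_segment[OF that] that inj_segment
    unfolding hcegis_identifies_def by meson
  define \<tau> where "\<tau> = (\<lambda>n. Some (proj1 n))"
  have "is_trace \<tau> (segment 0)"
    using is_trace_proj1[of UNIV] by (simp add: \<tau>_def segment_def)
  then obtain N where N: "\<And>n. n \<ge> N \<Longrightarrow> ?s \<tau> n = 0" using conv by blast
  have stuck: "F 0 (Some x) None = 0" for x
  proof -
    have "prod_encode (x, N) \<ge> N" by (rule le_prod_encode_2)
    then show ?thesis
      using N[of "prod_encode (x, N)"] N[of "Suc (prod_encode (x, N))"] by (simp add: \<tau>_def)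
  qed
  obtain k where k: "\<And>n. n < N \<Longrightarrow> proj1 n < k"
    using finite_nat_set_iff_bounded[of "proj1 ` {..<N}"] by auto
  define \<tau>' where "\<tau>' = (\<lambda>n. if n < N then Some (proj1 n) else Some (n mod Suc k))"
  have "is_trace \<tau>' (segment (Suc k))"
  proof -
    have "\<exists>n. \<tau>' n = Some x" if "x < Suc k" for x
    proof -
      have "\<not> x + Suc k * N < N" by simp
      then have "\<tau>' (x + Suc k * N) = Some x"
        using that by (simp add: \<tau>'_def del: mult_Suc)
      then show ?thesis by blast
    qed
    moreover have "x < Suc k" if "\<tau>' n = Some x" for n x
      using that k[of n] by (auto simp: \<tau>'_def split: if_splits)
    ultimately show ?thesis
      by (auto simp: is_trace_def SMPL_def segment_def)
  qed
  then obtain N' where N': "\<And>n. n \<ge> N' \<Longrightarrow> ?s \<tau>' n = Suc k" using conv by blast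
  have "?s \<tau>' n = ?s \<tau> n" if "n \<le> N" for n
    using that by (induction n) (auto simp: \<tau>'_def \<tau>_def)
  then have \<tau>'0: "?s \<tau>' N = 0" using N by simp
  have "?s \<tau>' n = 0" if "n \<ge> N" for n
    using that \<tau>'0 by (induction n rule: dec_induct) (auto simp: \<tau>'_def stuck)
  from this[of "max N N'"] N'[of "max N N'"] show False by simp
qed

section \<open>Spiked languages: identification from bounded counterexamples\<close>

abbreviation tg :: "nat \<Rightarrow> nat" where "tg i \<equiv> prod_encode (0, i)"
abbreviation zz :: "nat \<Rightarrow> nat" where "zz k \<equiv> prod_encode (Suc 0, k)"
abbreviation th :: "nat \<Rightarrow> nat" where "th t \<equiv> prod_encode (2, t)"

text \<open>\<open>tg\<close>, \<open>zz\<close> and \<open>th\<close> code the tags, the body elements and the marks. An index encodes either \<open>B i\<close> (second component \<open>0\<close>) or \<open>T(i,t,c,x)\<close>, where \<open>x\<close> is stored as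
  its distance from \<open>Suc c\<close>; \<open>mark\<close>, \<open>width\<close> and \<open>spike\<close> are junk on an index of some \<open>B i\<close>.\<close>

definition tag :: "nat \<Rightarrow> nat" where "tag p = proj1 p"
definition is_base :: "nat \<Rightarrow> bool" where "is_base p \<longleftrightarrow> proj2 p = 0"
definition mark :: "nat \<Rightarrow> nat" where "mark p = proj1 (proj2 p - 1)"
definition width :: "nat \<Rightarrow> nat" where "width p = proj1 (proj2 (proj2 p - 1))"
definition spike :: "nat \<Rightarrow> nat" where
  "spike p = Suc (width p + proj2 (proj2 (proj2 p - 1)))"

definition base :: "nat \<Rightarrow> nat" where "base i = prod_encode (i, 0)"
definition tip :: "nat \<Rightarrow> nat \<Rightarrow> nat \<Rightarrow> nat \<Rightarrow> nat" where
  "tip i t c x = prod_encode (i, Suc (prod_encode (t, prod_encode (c, x - Suc c))))"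

definition spiked :: "nat \<Rightarrow> nat set" where
  "spiked p = {tg (tag p)} \<union>
    (if is_base p then range zz else zz ` {..<width p} \<union> {zz (spike p), th (mark p)})"

lemma base_simps [simp]: "tag (base i) = i" "is_base (base i)"
  by (simp_all add: base_def tag_def is_base_def)

lemma tip_simps [simp]:
  "tag (tip i t c x) = i" "\<not> is_base (tip i t c x)" "mark (tip i t c x) = t"
  "width (tip i t c x) = c" "c < x \<Longrightarrow> spike (tip i t c x) = x"
  by (simp_all add: tip_def tag_def is_base_def mark_def width_def spike_def)

lemma width_less_spike: "width p < spike p"
  by (simp add: spike_def)

lemma prod_encode_proj [simp]: "prod_encode (proj1 n, proj2 n) = n"
  by (simp add: proj1_def proj2_def)

lemma base_tag: "is_base p \<Longrightarrow> base (tag p) = p"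
  unfolding base_def tag_def is_base_def by (metis prod_encode_proj)

lemma tip_selectors: "\<not> is_base p \<Longrightarrow> tip (tag p) (mark p) (width p) (spike p) = p"
  by (simp add: tip_def tag_def is_base_def mark_def width_def spike_def)

lemma spiked_simps [simp]:
  "tg i \<in> spiked p \<longleftrightarrow> i = tag p"
  "zz k \<in> spiked p \<longleftrightarrow> is_base p \<or> k < width p \<or> k = spike p"
  "th t \<in> spiked p \<longleftrightarrow> \<not> is_base p \<and> t = mark p"
  by (auto simp: spiked_def)

lemma spiked_cases:
  assumes "n \<in> spiked p"
  obtains "n = tg (tag p)" | k where "n = zz k" "is_base p \<or> k < width p \<or> k = spike p"
    | "n = th (mark p)" "\<not> is_base p"
  using assms by (auto simp: spiked_def split: if_splits)

lemma spiked_eqD: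
  assumes "spiked p = spiked p'"
  shows "p = p'"
proof -
  have tag: "tag p = tag p'"
    using spiked_simps(1)[of "tag p" p] assms by simp
  have "\<not> is_base p \<and> t = mark p \<longleftrightarrow> \<not> is_base p' \<and> t = mark p'" for t
    using spiked_simps(3)[of t p] spiked_simps(3)[of t p'] assms by simp
  then have base: "is_base p = is_base p'" and mark: "is_base p \<or> mark p = mark p'"
    by blast+
  show ?thesis
  proof (cases "is_base p")
    case True
    then show ?thesis using tag base base_tag by metis
  next
    case False
    have z: "k < width p \<or> k = spike p \<longleftrightarrow> k < width p' \<or> k = spike p'" for k
      using spiked_simps(2)[of k p] spiked_simps(2)[of k p'] assms base False by simp
    have width: "width p = width p'"
      using z[of "width p"] z[of "width p'"] width_less_spike[of p] width_less_spike[of p'] by auto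
    then have "spike p = spike p'"
      using z[of "spike p"] width_less_spike[of p] by auto
    then show ?thesis
      using False tag base mark width tip_selectors by metis
  qed
qed

lemma indexed_family_spiked: "indexed_family spiked"
proof -
  let ?f = "\<lambda>p n. if proj1 n = 0 then if proj2 n = tag p then 1 else (0::nat)
    else if proj1 n = 1 then if proj2 p = 0 then 1 else if proj2 n < width p then 1
      else if proj2 n = spike p then 1 else 0
    else if proj1 n = 2 then if proj2 p = 0 then 0 else if proj2 n = mark p then 1 else 0 else 0"
  have "(if n \<in> spiked p then 1 else 0) = ?f p n" for p n
  proof -
    obtain a k where n: "n = prod_encode (a, k)"
      by (metis prod_encode_proj)
    consider "a = 0" | "a = Suc 0" | "a = 2" | "a \<noteq> 0" "a \<noteq> Suc 0" "a \<noteq> 2" by blast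
    then show ?thesis
    proof cases
      case 4
      then have "n \<notin> spiked p" by (auto simp: n elim: spiked_cases)
      with 4 show ?thesis by (simp add: n)
    qed (simp_all add: n is_base_def)
  qed
  moreover have "total_recursive2 ?f"
    unfolding tag_def width_def spike_def mark_def
    by (rule total_recursive2I) (intro recursive_intros)
  moreover have "spiked i \<noteq> {}" for i by (simp add: spiked_def)
  ultimately show ?thesis
    unfolding indexed_family_def by presburger
qed

text \<open>Each component is searched monotonically so as not to pass the correct value; a gap
  found in the block lowers the width and restarts the spike right above it.\<close>

fun spiked_step :: "nat \<Rightarrow> nat option \<Rightarrow> nat option \<Rightarrow> nat" where
  "spiked_step p x None = p"
| "spiked_step p x (Some m) =
    (if proj1 m = 0 then prod_encode (Suc (tag p), proj2 p)
     else if is_base p then tip (tag p) 0 (proj2 m) (Suc (proj2 m))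
     else if proj1 m = 2 then tip (tag p) (Suc (mark p)) (width p) (spike p)
     else if proj2 m < width p then tip (tag p) (mark p) (proj2 m) (Suc (proj2 m))
     else tip (tag p) (mark p) (width p) (Suc (spike p)))"

lemma engine_spiked_step: "engine spiked spiked_step"
proof (rule engine_injective_family)
  have "spiked_step p (dec_opt x) (dec_opt c) = (if c = 0 then p
     else if proj1 (c - 1) = 0 then prod_encode (Suc (tag p), proj2 p)
     else if is_base p then tip (tag p) 0 (proj2 (c - 1)) (Suc (proj2 (c - 1)))
     else if proj1 (c - 1) = 2 then tip (tag p) (Suc (mark p)) (width p) (spike p)
     else if proj2 (c - 1) < width p then tip (tag p) (mark p) (proj2 (c - 1)) (Suc (proj2 (c - 1)))
     else tip (tag p) (mark p) (width p) (Suc (spike p)))" for p x c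
    by (cases c) auto
  then show "total_recursive3 (\<lambda>p x c. spiked_step p (dec_opt x) (dec_opt c))"
    unfolding tag_def is_base_def width_def spike_def mark_def tip_def
    by (simp only:) (intro recursive_intros)
qed (rule spiked_eqD)

text \<open>Once all of \<open>E\<close> has been shown, every wrong hypothesis has a counterexample
  below some element of \<open>E\<close>. Refutations lower \<open>\<Phi>\<close> and silence
  changes nothing, so \<open>i\<close> is reached.\<close>

lemma hcegis_identifiesI:
  fixes \<Phi> :: "nat \<Rightarrow> nat"
  assumes stay: "\<And>p x. F p x None = p"
    and init: "Inv p0" and E: "finite E" "E \<subseteq> L i"
    and step: "\<And>p x m e. Inv p \<Longrightarrow> m \<in> L p \<Longrightarrow> m \<notin> L i \<Longrightarrow> e \<in> L i \<Longrightarrow> m < e \<Longrightarrow>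
      Inv (F p x (Some m)) \<and> \<Phi> (F p x (Some m)) < \<Phi> p"
    and progress: "\<And>p. Inv p \<Longrightarrow> p \<noteq> i \<Longrightarrow> \<exists>m e. m \<in> L p \<and> m \<notin> L i \<and> e \<in> E \<and> m < e"
  shows "hcegis_identifies L F p0 i"
  unfolding hcegis_identifies_def
proof (intro allI impI)
  fix \<tau> cex
  define s where "s = hyp F p0 \<tau> cex"
  define S where "S n = {m. m \<in> L (s n) \<and> m \<notin> L i \<and> (\<exists>j<n. \<exists>x. \<tau> j = Some x \<and> m < x)}" for n
  assume \<tau>: "is_trace \<tau> (L i)"
  assume "\<forall>n. hcheck_ok (L i) (L (hyp F p0 \<tau> cex n)) \<tau> n (cex n)"
  then have cex: "S n = {} \<Longrightarrow> cex n = None" "S n \<noteq> {} \<Longrightarrow> \<exists>m\<in>S n. cex n = Some m" for n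
    by (simp_all add: hcheck_ok_def S_def s_def)
  have sS: "s (Suc n) = F (s n) (\<tau> n) (cex n)" for n
    by (simp add: s_def)
  have shown: "x \<in> L i" if "\<tau> j = Some x" for j x
    using \<tau> that by (auto simp: is_trace_def SMPL_def)
  have kick: "Inv (s (Suc n)) \<and> \<Phi> (s (Suc n)) < \<Phi> (s n)" if "Inv (s n)" "S n \<noteq> {}" for n
    using cex(2)[OF that(2)] that(1) step shown sS[of n] by (fastforce simp: S_def)
  have inv: "Inv (s n)" for n
  proof (induction n)
    case (Suc n)
    then show ?case
      using kick[of n] cex(1)[of n] sS[of n] stay by (cases "S n = {}") auto
  qed (simp add: s_def init)
  have "\<exists>N. \<forall>e\<in>E. \<exists>j<N. \<tau> j = Some e"
    using E
  proof (induction E rule: finite_induct)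
    case (insert e E)
    then obtain N where N: "\<forall>e\<in>E. \<exists>j<N. \<tau> j = Some e" by auto
    obtain j where "\<tau> j = Some e"
      using insert.prems \<tau> by (auto simp: is_trace_def SMPL_def)
    with N show ?case
      by (intro exI[of _ "max N (Suc j)"]) (auto simp: less_max_iff_disj)
  qed simp
  then obtain N where N: "\<And>e. e \<in> E \<Longrightarrow> \<exists>j<N. \<tau> j = Some e" by blast
  have "\<exists>N. \<forall>n\<ge>N. s n = i"
  proof (rule eventually_constant_if_decreasing)
    fix n assume "s n = i"
    then show "s (Suc n) = i"
      using cex(1)[of n] sS[of n] stay by (simp add: S_def)
  next
    fix n assume n: "n \<ge> N" "s n \<noteq> i"
    obtain m e where me: "m \<in> L (s n)" "m \<notin> L i" "e \<in> E" "m < e"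
      using progress[OF inv n(2)] by blast
    then obtain j where "j < n" "\<tau> j = Some e"
      using N[OF me(3)] n(1) by (meson less_le_trans)
    then have "m \<in> S n"
      using me by (auto simp: S_def)
    then show "\<Phi> (s (Suc n)) < \<Phi> (s n)"
      using kick[OF inv] by blast
  qed
  then show "\<exists>N. \<forall>n\<ge>N. L (hyp F p0 \<tau> cex n) = L i"
    by (auto simp: s_def)
qed

text \<open>Bounded verifiers compare codes; within one sort their order is that of the indices, so
  a tag, mark or spike that is too small lies below the correct one.\<close>

lemma prod_encode_strict_mono:
  assumes "j < k"
  shows "prod_encode (a, j) < prod_encode (a, k)"
proof -
  have "strict_mono (\<lambda>k. prod_encode (a, k))"
    unfolding strict_mono_Suc_iff by (simp add: prod_encode_def)
  then show ?thesis
    using assms by (rule strict_monoD)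
qed

lemma spiked_step_selectors [simp]:
  "tag (prod_encode (Suc (tag p), proj2 p)) = Suc (tag p)"
  "is_base (prod_encode (Suc (tag p), proj2 p)) = is_base p"
  "mark (prod_encode (Suc (tag p), proj2 p)) = mark p"
  "width (prod_encode (Suc (tag p), proj2 p)) = width p"
  "spike (prod_encode (Suc (tag p), proj2 p)) = spike p"
  by (simp_all add: tag_def is_base_def mark_def width_def spike_def)

text \<open>The target contains the whole body, so a base is refuted only by its tag and stays a
  base while the tag climbs.\<close>

lemma spiked_step_identifies_base:
  assumes "is_base i"
  shows "hcegis_identifies spiked spiked_step (base 0) i"
proof (rule hcegis_identifiesI[where Inv = "\<lambda>p. is_base p \<and> tag p \<le> tag i"
      and \<Phi> = "\<lambda>p. tag i - tag p" and E = "{tg (tag i)}"])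
  fix p x m e
  assume "is_base p \<and> tag p \<le> tag i" "m \<in> spiked p" "m \<notin> spiked i" "e \<in> spiked i" "m < e"
  then show "(is_base (spiked_step p x (Some m)) \<and> tag (spiked_step p x (Some m)) \<le> tag i) \<and>
      tag i - tag (spiked_step p x (Some m)) < tag i - tag p"
    using assms by (elim spiked_cases[of m p]) auto
next
  fix p
  assume p: "is_base p \<and> tag p \<le> tag i" "p \<noteq> i"
  then have "tag p < tag i"
    using assms base_tag by (metis le_neq_implies_less)
  then show "\<exists>m e. m \<in> spiked p \<and> m \<notin> spiked i \<and> e \<in> {tg (tag i)} \<and> m < e"
    using prod_encode_strict_mono[of "tag p" "tag i" 0] by - (rule exI[of _ "tg (tag p)"], rule exI[of _ "tg (tag i)"], auto)
qed simp_all

lemma spiked_step_identifies_tip: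
  assumes i: "\<not> is_base i"
  shows "hcegis_identifies spiked spiked_step (base 0) i"
proof -
  have "finite (spiked i)" using i by (simp add: spiked_def)
  then obtain M where M: "\<And>e. e \<in> spiked i \<Longrightarrow> e < M"
    by (auto simp: finite_nat_set_iff_bounded)
  \<comment> \<open>\<open>width\<close> approaches that of the target from above, while tag, mark and, for the right \<open>width\<close>,
    the spike approach from below; counterexamples stay below \<open>M\<close>, which bounds the restarts of
    the search for the spike.\<close>
  define Inv where "Inv p \<longleftrightarrow> tag p \<le> tag i \<and> (is_base p \<or> mark p \<le> mark i \<and> width i \<le> width p \<and>
    (width p = width i \<longrightarrow> spike p \<le> spike i) \<and> spike p \<le> M)" for p
  define W where "W = M + 2"
  \<comment> \<open>\<open>W\<close> exceeds \<open>M - spike p\<close>, so one unit of width pays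
    for restarting the spike; the value of a base exceeds that of the first tip, whose width is
    below \<open>M\<close>.\<close>
  define \<Phi> where "\<Phi> p = (tag i - tag p) + (if is_base p then mark i + M * W + M + 2
    else (mark i - mark p) + width p * W + (M - spike p))" for p
  let ?E = "{tg (tag i), zz (spike i), th (mark i)}"
  show ?thesis
  proof (rule hcegis_identifiesI[where Inv = Inv and \<Phi> = \<Phi> and E = ?E])
    fix p x m e
    assume p: "Inv p" and m: "m \<in> spiked p" "m \<notin> spiked i" and e: "e \<in> spiked i" "m < e"
    let ?q = "spiked_step p x (Some m)"
    have "m < M" using M[OF e(1)] e(2) by simp
    from m(1) show "Inv ?q \<and> \<Phi> ?q < \<Phi> p"
    proof (cases rule: spiked_cases)
      case 1
      then have "tag p \<noteq> tag i" using m(2) by simp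
      with 1 p show ?thesis by (auto simp: Inv_def \<Phi>_def)
    next
      case 3
      then have "mark p \<noteq> mark i" using m(2) i by simp
      with 3 p show ?thesis
        using width_less_spike[of p] by (auto simp: Inv_def \<Phi>_def)
    next
      case (2 k)
      have "k < M" using \<open>m < M\<close> 2(1) le_prod_encode_2[of k "Suc 0"] by simp
      have ik: "width i \<le> k" "k \<noteq> spike i" using m(2) 2(1) i by auto
      show ?thesis
      proof (cases "is_base p \<or> k < width p")
        case True
        have base: "k * W + (M - Suc k) < M * W + M + 2"
          using mult_le_mono1[of k M W] \<open>k < M\<close> by linarith
        have tip: "k * W + M + 2 \<le> width p * W" if "k < width p"
          using mult_le_mono1[of "Suc k" "width p" W] that by (simp add: W_def)
        have q: "?q = tip (tag p) (if is_base p then 0 else mark p) k (Suc k)"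
          using True 2(1) by auto
        \<comment> \<open>If \<open>k = width i\<close>, then \<open>Suc k \<le> spike i\<close>, as
          the spike lies beyond the width.\<close>
        then have "Inv ?q"
          using True p ik \<open>k < M\<close> width_less_spike[of i] by (auto simp: Inv_def)
        moreover have "\<Phi> ?q < \<Phi> p"
          unfolding q using True base tip by (cases "is_base p") (auto simp: \<Phi>_def)
        ultimately show ?thesis by blast
      next
        case False
        then have k: "k = spike p" "\<not> is_base p" using 2(2) by auto
        have q: "?q = tip (tag p) (mark p) (width p) (Suc (spike p))"
          using False 2(1) by auto
        have w: "width p < Suc (spike p)" using width_less_spike[of p] by simp
        then have "Inv ?q"
          unfolding q using p k ik \<open>k < M\<close> by (auto simp: Inv_def)
        moreover have "\<Phi> ?q < \<Phi> p"
          unfolding q using w k \<open>k < M\<close> by (simp add: \<Phi>_def)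
        ultimately show ?thesis by blast
      qed
    qed
  next
    fix p
    assume p: "Inv p" "p \<noteq> i"
    note less = prod_encode_strict_mono[of "tag p" "tag i" 0]
      prod_encode_strict_mono[of "mark p" "mark i" 2]
      prod_encode_strict_mono[of "width i" "spike i" "Suc 0"]
      prod_encode_strict_mono[of "spike p" "spike i" "Suc 0"]
    consider "tag p < tag i" | "is_base p" | "\<not> is_base p" "mark p < mark i"
      | "\<not> is_base p" "width i < width p" | "\<not> is_base p" "width p = width i" "spike p < spike i"
    proof (cases "tag p = tag i \<and> \<not> is_base p \<and> mark p = mark i \<and> width p = width i \<and> spike p = spike i")
      case True
      then have "p = i" using i tip_selectors by metis
      with p(2) show ?thesis by simp
    next
      case False
      then have "tag p < tag i \<or> is_base p \<or> mark p < mark i \<or> width i < width p \<or>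
          width p = width i \<and> spike p < spike i"
        using p(1) by (cases "is_base p") (auto simp: Inv_def le_less)
      then show ?thesis using that by blast
    qed
    \<comment> \<open>The witnesses are of the same sort. A base or too wide a block contains the
      first gap \<open>zz (width i)\<close> of the target, which lies below its spike.\<close>
    then show "\<exists>m e. m \<in> spiked p \<and> m \<notin> spiked i \<and> e \<in> ?E \<and> m < e"
    proof cases
      case 1
      then show ?thesis
        using less(1) by - (rule exI[of _ "tg (tag p)"], rule exI[of _ "tg (tag i)"], auto)
    next
      case 3
      then show ?thesis
        using less(2) i by - (rule exI[of _ "th (mark p)"], rule exI[of _ "th (mark i)"], auto)
    next
      case 5
      then show ?thesis
        using less(4) i width_less_spike[of p]
        by - (rule exI[of _ "zz (spike p)"], rule exI[of _ "zz (spike i)"], auto)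
    next
      case 2
      then show ?thesis
        using less(3) i width_less_spike[of i]
        by - (rule exI[of _ "zz (width i)"], rule exI[of _ "zz (spike i)"], auto)
    next
      case 4
      then show ?thesis
        using less(3) i width_less_spike[of i]
        by - (rule exI[of _ "zz (width i)"], rule exI[of _ "zz (spike i)"], auto)
    qed
  qed (use i in \<open>auto simp: Inv_def\<close>)
qed

lemma spiked_in_HCEGIS: "spiked \<in> HCEGIS"
proof -
  have "hcegis_identifies spiked spiked_step (base 0) i" for i
    using spiked_step_identifies_base spiked_step_identifies_tip by (cases "is_base i")
  then show ?thesis
    unfolding HCEGIS_def using indexed_family_spiked engine_spiked_step by blast
qed

section \<open>Spiked languages: no identification from arbitrary counterexamples\<close>

text \<open>Finite languages are shown by a list and then pauses forever.\<close>

definition list_trace :: "nat list \<Rightarrow> nat \<Rightarrow> nat option" where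
  "list_trace ys n = (if n < length ys then Some (ys ! n) else None)"

lemma is_trace_list_trace: "is_trace (list_trace ys) (set ys)"
proof -
  have "(\<exists>n. list_trace ys n = Some x) \<longleftrightarrow> x \<in> set ys" for x
    unfolding list_trace_def in_set_conv_nth by (metis option.distinct(1) option.inject)
  then show ?thesis by (simp add: is_trace_def SMPL_def)
qed

lemma list_trace_shift: "list_trace (ys @ zs) (length ys + n) = list_trace zs n"
  by (simp add: list_trace_def nth_append)

text \<open>The positional answers of a verifier for \<open>B b\<close>; they remain legitimate for any target \<open>T(b,t,c,x)\<close>
  as long as the mark \<open>t\<close> is not conjectured.\<close>

definition kick :: "nat \<Rightarrow> nat \<Rightarrow> nat option" where
  "kick b p = Some (if tag p \<noteq> b then tg (tag p) else th (mark p))"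

lemma check_ok_kick:
  assumes "p \<noteq> base b"
  shows "check_ok (spiked (base b)) (spiked p) (kick b p)"
proof -
  have "tag p = b \<Longrightarrow> \<not> is_base p" using assms base_tag by auto
  then have m: "the (kick b p) \<in> spiked p" "the (kick b p) \<notin> spiked (base b)"
    by (auto simp: kick_def)
  then have "\<not> spiked p \<subseteq> spiked (base b)" by blast
  with m show ?thesis by (auto simp: check_ok_def kick_def)
qed

text \<open>A legitimate verifier for \<open>spiked i\<close> that answers \<open>\<rho>\<close> whenever this is admissible.\<close>

definition answer :: "nat \<Rightarrow> (nat \<Rightarrow> nat) \<Rightarrow> nat \<Rightarrow> nat option" where
  "answer i \<rho> p = (if spiked p \<subseteq> spiked i then None
    else if \<rho> p \<in> spiked p - spiked i then Some (\<rho> p)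
    else Some (SOME m. m \<in> spiked p - spiked i))"

lemma check_ok_answer: "check_ok (spiked i) (spiked p) (answer i \<rho> p)"
proof (cases "spiked p \<subseteq> spiked i")
  case False
  then obtain m where "m \<in> spiked p - spiked i" by blast
  then have "(SOME m. m \<in> spiked p - spiked i) \<in> spiked p - spiked i" by (rule someI)
  with False show ?thesis by (simp add: check_ok_def answer_def)
qed (simp add: check_ok_def answer_def)

lemma answer_eq:
  assumes "\<rho> p \<in> spiked p" "\<rho> p \<notin> spiked i"
  shows "answer i \<rho> p = Some (\<rho> p)"
proof -
  have "\<not> spiked p \<subseteq> spiked i" using assms by blast
  with assms show ?thesis by (simp add: answer_def)
qed

text \<open>On such conjectures \<open>kick b\<close> is admissible for \<open>B b\<close> and for
  every \<open>T(b,t,c,x)\<close> alike.\<close>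

definition fresh :: "nat \<Rightarrow> nat \<Rightarrow> nat \<Rightarrow> bool" where
  "fresh b t p \<longleftrightarrow> p \<noteq> base b \<and> (tag p = b \<longrightarrow> mark p \<noteq> t)"

section \<open>Plays against positional verifiers\<close>

locale spiked_learner =
  fixes F :: "nat \<Rightarrow> nat option \<Rightarrow> nat option \<Rightarrow> nat" and p0 :: nat
  assumes identifies: "cegis_identifies spiked F p0 i"
begin

primrec run :: "nat \<Rightarrow> (nat \<Rightarrow> nat option) \<Rightarrow> (nat \<Rightarrow> nat option) \<Rightarrow> nat \<Rightarrow> nat" where
  "run p \<tau> r 0 = p"
| "run p \<tau> r (Suc n) = F (run p \<tau> r n) (\<tau> n) (r (run p \<tau> r n))"

lemma run_converges:
  assumes "is_trace \<tau> (spiked i)"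
    and "\<And>n. check_ok (spiked i) (spiked (run p0 \<tau> r n)) (r (run p0 \<tau> r n))"
  shows "\<exists>N. \<forall>n\<ge>N. run p0 \<tau> r n = i"
proof -
  have "hyp F p0 \<tau> (\<lambda>n. r (run p0 \<tau> r n)) n = run p0 \<tau> r n" for n
    by (induction n) auto
  then have "\<exists>N. \<forall>n\<ge>N. spiked (run p0 \<tau> r n) = spiked i"
    using identifies[unfolded cegis_identifies_def, rule_format, of \<tau> i "\<lambda>n. r (run p0 \<tau> r n)"]
      assms by simp
  then obtain N where "\<And>n. n \<ge> N \<Longrightarrow> spiked (run p0 \<tau> r n) = spiked i" by blast
  then have "\<forall>n\<ge>N. run p0 \<tau> r n = i" by (intro allI impI spiked_eqD)
  then show ?thesis ..
qed

lemma answer_run_converges: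
  assumes "is_trace \<tau> (spiked i)"
  shows "\<exists>N. \<forall>n\<ge>N. run p0 \<tau> (answer i \<rho>) n = i"
  using assms check_ok_answer by (rule run_converges)

lemma run_add: "run p \<tau> r (k + n) = run (run p \<tau> r k) (\<lambda>j. \<tau> (k + j)) r n"
  by (induction n) auto

lemma run_cong:
  assumes "\<And>k. k < n \<Longrightarrow> \<tau> k = \<tau>' k"
    and "\<And>k. k < n \<Longrightarrow> r (run p \<tau> r k) = r' (run p \<tau> r k)"
  shows "run p \<tau>' r' n = run p \<tau> r n"
  using assms by (induction n) auto

lemma run_append: "k \<le> length ys \<Longrightarrow> run p (list_trace (ys @ zs)) r k = run p (list_trace ys) r k"
  by (rule run_cong) (auto simp: list_trace_def nth_append)

text \<open>After convergence to \<open>i\<close> the verifier is silent, and a pause in the trace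
  then exhibits the fixed point.\<close>

lemma F_None_None: "F i None None = i"
proof -
  let ?\<tau> = "\<lambda>n. if proj1 n \<in> spiked i then Some (proj1 n) else None"
  obtain N where N: "\<And>n. n \<ge> N \<Longrightarrow> run p0 ?\<tau> (answer i id) n = i"
    using answer_run_converges[OF is_trace_proj1] by blast
  \<comment> \<open>\<open>prod_encode (3, 0)\<close> is of a sort found in no spiked language, so
    the trace pauses at this late position.\<close>
  define n where "n = prod_encode (prod_encode (3, 0), N)"
  have "n \<ge> N" by (simp add: n_def le_prod_encode_2)
  moreover have "?\<tau> n = None" by (auto simp: n_def elim: spiked_cases)
  moreover have "answer i id i = None" by (simp add: answer_def)
  ultimately show ?thesis
    using N[of n] N[of "Suc n"] by simp
qed

text \<open>After \<open>us\<close> and after \<open>vs x\<close> the learner is in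
  \<open>base b\<close>, so one continuation must serve both \<open>T\<close> and
  \<open>U x\<close>. Reaching \<open>T\<close> forces a fatal conjecture, from which a suitable
  \<open>U x\<close> is unreachable. \<open>\<rho>\<^sub>0\<close> does not mention
  \<open>t\<close>, so \<open>t\<close> can be chosen once the play along \<open>\<sigma>\<close> is
  known.\<close>

lemma no_ambiguous_arrivals:
  fixes b m t :: nat
  defines "\<sigma> \<equiv> map zz [0..<m] @ [tg b, zz (Suc m)]"
  defines "\<rho>\<^sub>0 \<equiv> \<lambda>p. if tag p \<noteq> b then tg (tag p) else if is_base p then zz (m + 2) else th (mark p)"
  assumes us: "set us \<subseteq> insert (tg b) (zz ` {..<m})"
      "run p0 (list_trace us) (kick b) (length us) = base b"
      "\<And>k. k < length us \<Longrightarrow> fresh b t (run p0 (list_trace us) (kick b) k)"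
    and X: "infinite X"
    and vs: "\<And>x. x \<in> X \<Longrightarrow> m + 2 < x"
      "\<And>x. x \<in> X \<Longrightarrow> {zz m, zz x} \<subseteq> set (vs x)"
      "\<And>x. x \<in> X \<Longrightarrow> set (vs x) \<subseteq> insert (tg b) (zz ` insert x {..m})"
      "\<And>x. x \<in> X \<Longrightarrow> run p0 (list_trace (vs x)) (kick b) (length (vs x)) = base b"
      "\<And>x k. x \<in> X \<Longrightarrow> k < length (vs x) \<Longrightarrow> fresh b t (run p0 (list_trace (vs x)) (kick b) k)"
    and post_fresh: "\<And>k p. k \<le> length \<sigma> \<Longrightarrow> p = run (base b) (list_trace \<sigma>) (\<lambda>p. Some (\<rho>\<^sub>0 p)) k \<Longrightarrow>
      tag p = b \<Longrightarrow> \<not> is_base p \<Longrightarrow> mark p \<noteq> t"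
  shows False
proof -
  \<comment> \<open>\<open>zz (m + 2)\<close> is in \<open>B b\<close> and in tips wider than
    \<open>m + 2\<close>, but in no target: it exceeds the spike of \<open>T\<close>, is outside the
    block of \<open>U x\<close>, and is below \<open>x\<close>.\<close>
  define \<rho> where "\<rho> p = (if tag p \<noteq> b then tg (tag p) else if is_base p then zz (m + 2)
    else if mark p \<noteq> t then th (mark p) else if m + 2 < width p then zz (m + 2)
    else zz (spike p))" for p
  \<comment> \<open>Fatal conjectures are those contained in all candidates \<open>U x\<close>; on the others, \<open>\<rho>\<close> is
    admissible both for \<open>T\<close> and for every \<open>U x\<close> whose \<open>x\<close> is not the conjectured spike.\<close>
  define fatal where "fatal p \<longleftrightarrow> tag p = b \<and> \<not> is_base p \<and> mark p = t \<and> width p \<le> m + 2 \<and>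
    spike p < m + 2" for p
  define ws where "ws = \<sigma> @ [th t]"
  define post where "post = run (base b) (list_trace ws) (\<lambda>p. Some (\<rho> p))"
  define T where "T = tip b t m (Suc m)"
  define U where "U x = tip b t (m + 2) x" for x
  have set_ws: "set ws = insert (th t) (insert (tg b) (insert (zz (Suc m)) (zz ` {..<m})))"
    by (auto simp: ws_def \<sigma>_def)
  have T: "spiked T = set ws"
    by (auto simp: T_def spiked_def set_ws)
  have U: "spiked (U x) = set (vs x) \<union> set ws" if "x \<in> X" for x
  proof -
    have "spiked (U x) = insert (th t) (insert (tg b) (zz ` insert x {..<m + 2}))"
      using vs(1)[OF that] by (auto simp: U_def spiked_def)
    also have "{..<m + 2} = insert (Suc m) (insert m {..<m})"
      by auto
    finally have "spiked (U x) = insert (zz m) (insert (zz x) (set ws))"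
      by (auto simp: set_ws)
    moreover have "{..m} = insert m {..<m}"
      by auto
    ultimately show ?thesis
      using vs(2,3)[OF that] by (auto simp: set_ws)
  qed
  have \<rho>: "\<rho> p \<in> spiked p" for p
    by (auto simp: \<rho>_def)
  have \<rho>T: "\<rho> p \<notin> spiked T" if "\<not> fatal p" for p
    using that by (auto simp: \<rho>_def T_def fatal_def)
  have \<rho>U: "\<rho> p \<notin> spiked (U x)" if "\<not> fatal p" "x \<in> X" "spike p \<noteq> x" for p x
    using that vs(1)[of x] by (auto simp: \<rho>_def U_def fatal_def)
  have fresh: "kick b p = Some (\<rho> p)" "\<rho> p \<notin> spiked T" "x \<in> X \<Longrightarrow> \<rho> p \<notin> spiked (U x)"
    if "fresh b t p" for p x
  proof -
    have "tag p = b \<Longrightarrow> \<not> is_base p" using that base_tag by (auto simp: fresh_def)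
    with that show "kick b p = Some (\<rho> p)" "\<rho> p \<notin> spiked T" "x \<in> X \<Longrightarrow> \<rho> p \<notin> spiked (U x)"
      by (auto simp: fresh_def kick_def \<rho>_def T_def U_def)
  qed
  \<comment> \<open>During \<open>ys\<close> the answers of \<open>\<rho>\<close> and
    \<open>kick b\<close> coincide; arrival at \<open>base b\<close> erases \<open>ys\<close>, so
    the rest is \<open>post\<close> while \<open>\<rho>\<close> is admissible.\<close>
  have glue: "run p0 (list_trace (ys @ ws)) (answer i \<rho>) (length ys + n) = post n"
    if ys: "run p0 (list_trace ys) (kick b) (length ys) = base b"
      "\<And>k. k < length ys \<Longrightarrow> fresh b t (run p0 (list_trace ys) (kick b) k)"
      and i: "\<And>p. fresh b t p \<Longrightarrow> \<rho> p \<notin> spiked i"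
      and n: "\<And>k. k < n \<Longrightarrow> \<rho> (post k) \<notin> spiked i" for ys i n
  proof -
    have "run p0 (list_trace (ys @ ws)) (answer i \<rho>) (length ys) =
        run p0 (list_trace ys) (kick b) (length ys)"
    proof (rule run_cong)
      fix k assume "k < length ys"
      then show "list_trace ys k = list_trace (ys @ ws) k"
        by (simp add: list_trace_def nth_append)
      have f: "fresh b t (run p0 (list_trace ys) (kick b) k)"
        using \<open>k < length ys\<close> by (rule ys(2))
      show "kick b (run p0 (list_trace ys) (kick b) k) = answer i \<rho> (run p0 (list_trace ys) (kick b) k)"
        unfolding fresh(1)[OF f] answer_eq[where \<rho> = \<rho>, OF \<rho> i[OF f]] ..
    qed
    then have "run p0 (list_trace (ys @ ws)) (answer i \<rho>) (length ys + n) =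
        run (base b) (list_trace ws) (answer i \<rho>) n"
      by (simp add: run_add list_trace_shift ys(1))
    also have "\<dots> = post n"
      unfolding post_def
    proof (rule run_cong)
      fix k assume "k < n"
      then show "Some (\<rho> (run (base b) (list_trace ws) (\<lambda>p. Some (\<rho> p)) k)) =
          answer i \<rho> (run (base b) (list_trace ws) (\<lambda>p. Some (\<rho> p)) k)"
        using answer_eq[where \<rho> = \<rho>, OF \<rho> n[of k]] unfolding post_def by simp
    qed simp
    finally show ?thesis .
  qed
  have "\<exists>n. fatal (post n)"
  proof (rule ccontr)
    assume nf: "\<nexists>n. fatal (post n)"
    have "is_trace (list_trace (us @ ws)) (spiked T)"
    proof -
      have "set us \<subseteq> set ws" using us(1) by (auto simp: set_ws)
      then show ?thesis
        using is_trace_list_trace[of "us @ ws"] by (simp add: T sup.absorb2)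
    qed
    then obtain N where "\<And>n. n \<ge> N \<Longrightarrow> run p0 (list_trace (us @ ws)) (answer T \<rho>) n = T"
      using answer_run_converges by blast
    then have "run p0 (list_trace (us @ ws)) (answer T \<rho>) (length us + N) = T"
      by simp
    moreover have "run p0 (list_trace (us @ ws)) (answer T \<rho>) (length us + N) = post N"
      using us(2,3) fresh(2) by (rule glue) (use \<rho>T nf in blast)+
    ultimately have "post N = T"
      by simp
    then have "fatal (post N)" by (simp add: T_def fatal_def)
    with nf show False by blast
  qed
  then obtain n where n: "fatal (post n)" "\<And>k. k < n \<Longrightarrow> \<not> fatal (post k)"
    using exists_least_iff[of "\<lambda>n. fatal (post n)"] by blast
  have \<rho>\<^sub>0: "Some (\<rho>\<^sub>0 p) = Some (\<rho> p)" if "tag p = b \<Longrightarrow> \<not> is_base p \<Longrightarrow> mark p \<noteq> t" for p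
    using that by (auto simp: \<rho>_def \<rho>\<^sub>0_def)
  have post0: "post k = run (base b) (list_trace \<sigma>) (\<lambda>p. Some (\<rho>\<^sub>0 p)) k" if "k \<le> length \<sigma>" for k
    unfolding post_def
  proof (rule run_cong)
    fix j assume "j < k"
    then show "list_trace \<sigma> j = list_trace ws j"
      using that by (simp add: ws_def list_trace_def nth_append)
    show "Some (\<rho>\<^sub>0 (run (base b) (list_trace \<sigma>) (\<lambda>p. Some (\<rho>\<^sub>0 p)) j)) =
        Some (\<rho> (run (base b) (list_trace \<sigma>) (\<lambda>p. Some (\<rho>\<^sub>0 p)) j))"
      by (rule \<rho>\<^sub>0, rule post_fresh[OF _ refl]) (use \<open>j < k\<close> that in auto)
  qed
  \<comment> \<open>No conjecture along \<open>\<sigma>\<close> is a tip with tag \<open>b\<close>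
    and mark \<open>t\<close>, so fatality comes only once \<open>ws\<close>, which ends in
    \<open>th t\<close>, is exhausted.\<close>
  have "length \<sigma> < n"
  proof (rule ccontr)
    assume "\<not> length \<sigma> < n"
    then have "n \<le> length \<sigma>" by simp
    from post_fresh[OF this post0[OF this]] n(1) show False
      unfolding fatal_def by blast
  qed
  \<comment> \<open>Avoiding the finitely many spikes conjectured before step \<open>n\<close> keeps
    all answers up to then admissible for \<open>U x\<close>.\<close>
  have "infinite (X - (\<lambda>k. spike (post k)) ` {..<n})"
    using X by (simp add: Diff_infinite_finite)
  then obtain x where "x \<in> X - (\<lambda>k. spike (post k)) ` {..<n}"
    using infinite_imp_nonempty by blast
  then have x: "x \<in> X" "\<And>k. k < n \<Longrightarrow> spike (post k) \<noteq> x"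
    by auto
  let ?s = "run p0 (list_trace (vs x @ ws)) (answer (U x) \<rho>)"
  have "is_trace (list_trace (vs x @ ws)) (spiked (U x))"
    using is_trace_list_trace[of "vs x @ ws"] by (simp add: U[OF x(1)])
  then obtain N where N: "\<And>n. n \<ge> N \<Longrightarrow> ?s n = U x"
    using answer_run_converges by blast
  have start: "?s (length (vs x) + n) = post n"
  proof (rule glue[OF vs(4,5)[OF x(1)]])
    show "\<rho> p \<notin> spiked (U x)" if "fresh b t p" for p
      using that x(1) by (rule fresh(3))
    show "\<rho> (post k) \<notin> spiked (U x)" if "k < n" for k
      using \<rho>U[OF n(2)[OF that] x(1) x(2)[OF that]] .
  qed
  \<comment> \<open>The verifier is now silent and the trace pauses, so \<open>F_None_None\<close>
    freezes the play on a conjecture other than \<open>U x\<close>.\<close>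
  have "spiked (post n) \<subseteq> spiked (U x)"
    using n(1) vs(1)[OF x(1)] by (auto simp: fatal_def spiked_def U_def)
  then have none: "answer (U x) \<rho> (post n) = None"
    by (simp add: answer_def)
  have "?s (length (vs x) + k) = post n" if "k \<ge> n" for k
    using that
  proof (induction k rule: dec_induct)
    case (step k)
    have "list_trace (vs x @ ws) (length (vs x) + k) = None"
      using step \<open>length \<sigma> < n\<close> by (simp add: list_trace_def ws_def)
    then show ?case using step none F_None_None by simp
  qed (rule start)
  from this[of "max n N"] N[of "length (vs x) + max n N"] have "post n = U x" by simp
  then show False
    using n(1) vs(1)[OF x(1)] by (simp add: fatal_def U_def)
qed

text \<open>This supplies the parameters: \<open>m\<close> is the largest body index in
  \<open>S\<close>, and \<open>k\<^sub>0\<close> ensures that \<open>us\<close> stays below it;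
  \<open>t\<close> is a mark missing from the relevant plays for infinitely many
  \<open>x\<close>.\<close>

lemma no_infinite_arrivals:
  assumes us: "set us \<subseteq> insert (tg b) (zz ` {..<m\<^sub>0})"
      "run p0 (list_trace us) (kick b) (length us) = base b"
      "\<And>k. k < length us \<Longrightarrow> run p0 (list_trace us) (kick b) k \<noteq> base b"
    and S: "finite S" "S \<subseteq> spiked (base b)" "zz k\<^sub>0 \<in> S" "m\<^sub>0 \<le> k\<^sub>0"
    and X: "infinite X" and E: "finite E"
    and vs: "\<And>x. x \<in> X \<Longrightarrow> set (vs x) = insert (zz x) S"
      "\<And>x. x \<in> X \<Longrightarrow> run p0 (list_trace (vs x)) (kick b) (length (vs x)) = base b"
      "\<And>x k. x \<in> X \<Longrightarrow> k < length (vs x) \<Longrightarrow> run p0 (list_trace (vs x)) (kick b) k \<noteq> base b"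
      "\<And>x k. x \<in> X \<Longrightarrow> k < length (vs x) \<Longrightarrow>
        mark (run p0 (list_trace (vs x)) (kick b) k) \<in> insert (g x) E"
  shows False
proof -
  define K where "K = {k. zz k \<in> S}"
  have "finite (zz -` S)"
    using S(1) by (rule finite_vimageI) (simp add: inj_def)
  then have K: "finite K" "k\<^sub>0 \<in> K"
    using S(3) by (auto simp: K_def vimage_def)
  define m where "m = Max K"
  have m: "zz m \<in> S" "k\<^sub>0 \<le> m" "\<And>k. zz k \<in> S \<Longrightarrow> k \<le> m"
    using Max_in[of K] K Max_ge[of K] unfolding m_def by (auto simp: K_def)
  have Sm: "S \<subseteq> insert (tg b) (zz ` {..m})"
  proof
    fix y assume "y \<in> S"
    then have "y \<in> spiked (base b)" using S(2) by blast
    then show "y \<in> insert (tg b) (zz ` {..m})"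
      using m(3) \<open>y \<in> S\<close> by (cases rule: spiked_cases) auto
  qed
  let ?\<sigma> = "map zz [0..<m] @ [tg b, zz (Suc m)]"
  let ?post = "run (base b) (list_trace ?\<sigma>)
    (\<lambda>p. Some (if tag p \<noteq> b then tg (tag p) else if is_base p then zz (m + 2) else th (mark p)))"
  define E' where "E' = E \<union> (\<lambda>k. mark (run p0 (list_trace us) (kick b) k)) ` {..<length us}
    \<union> (\<lambda>k. mark (?post k)) ` {..length ?\<sigma>}"
  have "finite E'" using E by (simp add: E'_def)
  \<comment> \<open>Only the mark \<open>g x\<close> depends on \<open>x\<close>, so one of two marks outside \<open>E'\<close> is fresh for infinitely
    many \<open>x\<close>.\<close>
  obtain t\<^sub>1 where t1: "t\<^sub>1 \<notin> E'"
    using ex_new_if_finite[OF infinite_UNIV_nat \<open>finite E'\<close>] by blast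
  obtain t\<^sub>2 where t2: "t\<^sub>2 \<notin> insert t\<^sub>1 E'"
    using ex_new_if_finite[OF infinite_UNIV_nat] \<open>finite E'\<close> by (metis finite_insert)
  have "X = {x \<in> X. g x \<noteq> t\<^sub>1} \<union> {x \<in> X. g x \<noteq> t\<^sub>2}" using t2 by auto
  then have "infinite {x \<in> X. g x \<noteq> t\<^sub>1} \<or> infinite {x \<in> X. g x \<noteq> t\<^sub>2}"
    using X by (metis finite_UnI)
  then obtain t where t: "t \<notin> E'" "infinite {x \<in> X. g x \<noteq> t}"
    using t1 t2 by blast
  define Y where "Y = {x \<in> X. g x \<noteq> t} - {..m + 2}"
  show False
  proof (rule no_ambiguous_arrivals[of us b m t Y vs])
    show "set us \<subseteq> insert (tg b) (zz ` {..<m})"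
      using us(1) S(4) m(2) by fastforce
    show "fresh b t (run p0 (list_trace us) (kick b) k)" if "k < length us" for k
      using us(3)[OF that] t(1) that by (auto simp: fresh_def E'_def)
    show "infinite Y"
      using t(2) by (simp add: Y_def Diff_infinite_finite)
    fix x assume "x \<in> Y"
    then have x: "x \<in> X" "g x \<noteq> t" "m + 2 < x" by (auto simp: Y_def)
    show "m + 2 < x" by (rule x(3))
    show "{zz m, zz x} \<subseteq> set (vs x)"
      using vs(1)[OF x(1)] m(1) by simp
    show "set (vs x) \<subseteq> insert (tg b) (zz ` insert x {..m})"
      using vs(1)[OF x(1)] Sm by auto
    show "run p0 (list_trace (vs x)) (kick b) (length (vs x)) = base b"
      by (rule vs(2)[OF x(1)])
    show "fresh b t (run p0 (list_trace (vs x)) (kick b) k)" if "k < length (vs x)" for k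
      using vs(3,4)[OF x(1) that] x(2) t(1) by (auto simp: fresh_def E'_def)
  next
    fix k p assume "k \<le> length ?\<sigma>" "p = ?post k"
    then have "mark p \<in> E'" unfolding E'_def by blast
    then show "mark p \<noteq> t" using t(1) by blast
  qed (rule us(2))
qed

text \<open>If every \<open>x\<close> led to \<open>base b\<close>, infinitely many would arrive at
  the same one of the two new steps.\<close>

lemma extend_nonarriving:
  assumes us: "set us \<subseteq> insert (tg b) (zz ` {..<m\<^sub>0})"
      "run p0 (list_trace us) (kick b) (length us) = base b"
      "\<And>k. k < length us \<Longrightarrow> run p0 (list_trace us) (kick b) k \<noteq> base b"
    and ys: "set ys \<subseteq> spiked (base b)" "zz k\<^sub>0 \<in> set ys" "m\<^sub>0 \<le> k\<^sub>0"
      "\<And>k. k \<le> length ys \<Longrightarrow> run p0 (list_trace ys) (kick b) k \<noteq> base b"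
    and s: "s \<in> spiked (base b)"
  shows "\<exists>x. \<forall>k \<le> length ys + 2. run p0 (list_trace (ys @ [zz x, s])) (kick b) k \<noteq> base b"
proof (rule ccontr)
  let ?R = "\<lambda>zs. run p0 (list_trace zs) (kick b)"
  let ?n = "length ys"
  assume "\<not> ?thesis"
  then have arrive: "\<exists>k \<le> ?n + 2. ?R (ys @ [zz x, s]) k = base b" for x
    by blast
  have pre: "?R (ys @ zs) k = ?R ys k" if "k \<le> ?n" for zs k
    using that by (rule run_append)
  have pre1: "?R (ys @ [zz x, s]) (Suc ?n) = ?R (ys @ [zz x]) (Suc ?n)" for x
    using run_append[of "Suc ?n" "ys @ [zz x]" p0 "[s]" "kick b"] by simp
  define E where "E = (\<lambda>k. mark (?R ys k)) ` {..?n}"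
  have E: "finite E" "\<And>k. k \<le> ?n \<Longrightarrow> mark (?R ys k) \<in> E"
    by (auto simp: E_def)
  define X where "X = {x. ?R (ys @ [zz x]) (Suc ?n) = base b}"
  show False
  proof (cases "finite X")
    case False
    \<comment> \<open>Arrival on \<open>zz x\<close>: all earlier conjectures are independent of
      \<open>x\<close>, so \<open>g\<close> is a dummy.\<close>
    show False
    proof (rule no_infinite_arrivals[OF us, of "set ys" k\<^sub>0 X E "\<lambda>x. ys @ [zz x]" "\<lambda>x. 0"])
      fix x k assume "x \<in> X" "k < length (ys @ [zz x])"
      then have "k \<le> ?n" by simp
      then show "?R (ys @ [zz x]) k \<noteq> base b" "mark (?R (ys @ [zz x]) k) \<in> insert 0 E"
        using ys(4) E(2) by (simp_all add: pre)
    qed (use ys False E X_def in auto)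
  next
    case True
    then have inf: "infinite (- X)" by (simp add: finite_compl)
    have last: "?R (ys @ [zz x, s]) (?n + 2) = base b" if "x \<in> - X" for x
    proof -
      obtain k where k: "k \<le> ?n + 2" "?R (ys @ [zz x, s]) k = base b"
        using arrive by blast
      have "\<not> k \<le> ?n" using k(2) ys(4) pre by metis
      moreover have "k \<noteq> Suc ?n" using k(2) that pre1 by (auto simp: X_def)
      ultimately have "k = ?n + 2" using k(1) by simp
      with k(2) show ?thesis by simp
    qed
    \<comment> \<open>Arrival on \<open>s\<close>: only the conjecture after \<open>zz x\<close>
      varies with \<open>x\<close>, and its mark is \<open>g x\<close>.\<close>
    show False
    proof (rule no_infinite_arrivals[OF us, of "insert s (set ys)" k\<^sub>0 "- X" E
          "\<lambda>x. ys @ [zz x, s]" "\<lambda>x. mark (?R (ys @ [zz x]) (Suc ?n))"])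
      fix x k assume x: "x \<in> - X" and "k < length (ys @ [zz x, s])"
      then consider "k \<le> ?n" | "k = Suc ?n" by fastforce
      then have "?R (ys @ [zz x, s]) k \<noteq> base b \<and> mark (?R (ys @ [zz x, s]) k)
          \<in> insert (mark (?R (ys @ [zz x]) (Suc ?n))) E"
      proof cases
        case 1
        then show ?thesis using ys(4) E(2) by (simp add: pre)
      next
        case 2
        show ?thesis using x unfolding 2 pre1 by (simp add: X_def)
      qed
      then show "?R (ys @ [zz x, s]) k \<noteq> base b" "mark (?R (ys @ [zz x, s]) k)
          \<in> insert (mark (?R (ys @ [zz x]) (Suc ?n))) E"
        by blast+
    next
      show "?R (ys @ [zz x, s]) (length (ys @ [zz x, s])) = base b" if "x \<in> - X" for x
        using last[OF that] by simp
    qed (use ys s inf E in auto)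
  qed
qed

end

section \<open>A full trace of \<open>B b\<close> on which the learner never arrives\<close>

definition base_enum :: "nat \<Rightarrow> nat \<Rightarrow> nat" where
  "base_enum b n = (case n of 0 \<Rightarrow> tg b | Suc k \<Rightarrow> zz k)"

lemma range_base_enum: "range (base_enum b) = spiked (base b)"
proof -
  have "base_enum b 0 = tg b" "\<And>k. base_enum b (Suc k) = zz k" by (simp_all add: base_enum_def)
  then have "spiked (base b) \<subseteq> range (base_enum b)"
    by (auto simp: spiked_def intro: range_eqI[OF sym])
  moreover have "range (base_enum b) \<subseteq> spiked (base b)"
    by (auto simp: base_enum_def spiked_def split: nat.split)
  ultimately show ?thesis by blast
qed

context spiked_learner
begin

text \<open>Shown all of \<open>B b\<close>, the learner must arrive; up to its first arrival the
  verifier's answers are those of \<open>kick b\<close>.\<close>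

lemma arrival_exists:
  obtains us m where "set us \<subseteq> insert (tg b) (zz ` {..<m})"
    "run p0 (list_trace us) (kick b) (length us) = base b"
    "\<And>k. k < length us \<Longrightarrow> run p0 (list_trace us) (kick b) k \<noteq> base b"
proof -
  define \<tau> where "\<tau> n = Some (base_enum b n)" for n
  define r where "r p = (if p = base b then None else kick b p)" for p
  have "is_trace \<tau> (spiked (base b))"
    unfolding range_base_enum[symmetric] by (auto simp: is_trace_def SMPL_def \<tau>_def)
  moreover have "check_ok (spiked (base b)) (spiked p) (r p)" for p
    using check_ok_kick by (auto simp: r_def check_ok_def)
  ultimately have "\<exists>n. run p0 \<tau> r n = base b"
    using run_converges[of \<tau> "base b" r] by blast
  then obtain n where n: "run p0 \<tau> r n = base b" "\<And>k. k < n \<Longrightarrow> run p0 \<tau> r k \<noteq> base b"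
    using exists_least_iff[of "\<lambda>n. run p0 \<tau> r n = base b"] by blast
  define us where "us = map (base_enum b) [0..<n]"
  have eq: "run p0 (list_trace us) (kick b) k = run p0 \<tau> r k" if "k \<le> n" for k
  proof (rule run_cong)
    fix j assume "j < k"
    then show "\<tau> j = list_trace us j" "r (run p0 \<tau> r j) = kick b (run p0 \<tau> r j)"
      using that n(2)[of j] by (simp_all add: \<tau>_def us_def list_trace_def r_def)
  qed
  show thesis
  proof (rule that[of us n])
    show "set us \<subseteq> insert (tg b) (zz ` {..<n})"
      by (auto simp: us_def base_enum_def split: nat.split)
  qed (use eq n in \<open>auto simp: us_def\<close>)
qed

lemma inconsistent: False
proof -
  \<comment> \<open>The first answer is the same for both tags, so the conjecture after it differs from
    \<open>base b\<close> for one of them.\<close>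
  obtain us\<^sub>1 m\<^sub>1 where us1: "set us\<^sub>1 \<subseteq> insert (tg (Suc (tag p0))) (zz ` {..<m\<^sub>1})"
    "run p0 (list_trace us\<^sub>1) (kick (Suc (tag p0))) (length us\<^sub>1) = base (Suc (tag p0))"
    "\<And>k. k < length us\<^sub>1 \<Longrightarrow> run p0 (list_trace us\<^sub>1) (kick (Suc (tag p0))) k \<noteq> base (Suc (tag p0))"
    by (rule arrival_exists[of "Suc (tag p0)"]) blast
  obtain us\<^sub>2 m\<^sub>2 where us2: "set us\<^sub>2 \<subseteq> insert (tg (Suc (Suc (tag p0)))) (zz ` {..<m\<^sub>2})"
    "run p0 (list_trace us\<^sub>2) (kick (Suc (Suc (tag p0)))) (length us\<^sub>2) = base (Suc (Suc (tag p0)))"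
    "\<And>k. k < length us\<^sub>2 \<Longrightarrow> run p0 (list_trace us\<^sub>2) (kick (Suc (Suc (tag p0)))) k \<noteq> base (Suc (Suc (tag p0)))"
    by (rule arrival_exists[of "Suc (Suc (tag p0))"]) blast
  \<comment> \<open>This bounds both candidate plays; \<open>zz m\<close> as first example is the
    body element beyond \<open>us\<close> that \<open>extend_nonarriving\<close> requires.\<close>
  define m where "m = max m\<^sub>1 m\<^sub>2"
  have "base (Suc (tag p0)) \<noteq> base (Suc (Suc (tag p0)))"
    by (metis base_simps(1) n_not_Suc_n)
  then obtain b us where b: "b \<noteq> tag p0" "F p0 (Some (zz m)) (Some (tg (tag p0))) \<noteq> base b"
    and us: "set us \<subseteq> insert (tg b) (zz ` {..<m})"
      "run p0 (list_trace us) (kick b) (length us) = base b"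
      "\<And>k. k < length us \<Longrightarrow> run p0 (list_trace us) (kick b) k \<noteq> base b"
  proof (cases "F p0 (Some (zz m)) (Some (tg (tag p0))) = base (Suc (tag p0))")
    case True
    then show thesis
      using \<open>base (Suc (tag p0)) \<noteq> base (Suc (Suc (tag p0)))\<close> us2
      by (intro that[of "Suc (Suc (tag p0))" us\<^sub>2]) (fastforce simp: m_def)+
  next
    case False
    then show thesis
      using us1 by (intro that[of "Suc (tag p0)" us\<^sub>1]) (fastforce simp: m_def)+
  qed
  define good where "good ys \<longleftrightarrow> set ys \<subseteq> spiked (base b) \<and> zz m \<in> set ys \<and>
    (\<forall>k \<le> length ys. run p0 (list_trace ys) (kick b) k \<noteq> base b)" for ys
  have "good [zz m]"
  proof -
    have "run p0 (list_trace [zz m]) (kick b) k \<noteq> base b" if "k \<le> Suc 0" for k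
      using that b by (cases k) (auto simp: list_trace_def kick_def)
    then show ?thesis by (simp add: good_def)
  qed
  have ex: "\<exists>zs. good (ys @ zs) \<and> zs \<noteq> [] \<and> s \<in> set zs" if g: "good ys" "s \<in> spiked (base b)" for ys s
  proof -
    obtain x where "\<forall>k \<le> length ys + 2. run p0 (list_trace (ys @ [zz x, s])) (kick b) k \<noteq> base b"
      using extend_nonarriving[OF us(1,2), of ys m s] us(3) g unfolding good_def by auto
    then have "good (ys @ [zz x, s])"
      using g by (simp add: good_def)
    then show ?thesis by (intro exI[of _ "[zz x, s]"]) simp
  qed
  define next_ys where "next_ys ys s = ys @ (SOME zs. good (ys @ zs) \<and> zs \<noteq> [] \<and> s \<in> set zs)" for ys s
  define seq where "seq = rec_nat [zz m] (\<lambda>n ys. next_ys ys (base_enum b n))"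
  have seq_Suc: "\<exists>zs. seq (Suc n) = seq n @ zs \<and> zs \<noteq> [] \<and> base_enum b n \<in> set zs \<and> good (seq (Suc n))"
    if "good (seq n)" for n
  proof -
    have "base_enum b n \<in> spiked (base b)" using range_base_enum by blast
    from someI_ex[OF ex[OF that this]] show ?thesis
      by (auto simp: seq_def next_ys_def)
  qed
  have good: "good (seq n)" for n
  proof (induction n)
    case 0
    show ?case using \<open>good [zz m]\<close> by (simp add: seq_def)
  next
    case (Suc n)
    then show ?case using seq_Suc by blast
  qed
  have len: "n < length (seq n)" for n
  proof (induction n)
    case (Suc n)
    obtain zs where "seq (Suc n) = seq n @ zs" "zs \<noteq> []" using seq_Suc[OF good] by blast
    with Suc show ?case by (cases zs) auto
  qed (simp add: seq_def)
  have pre: "j \<le> n \<Longrightarrow> k < length (seq j) \<Longrightarrow> k < length (seq n) \<and> seq n ! k = seq j ! k" for j n k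
  proof (induction n rule: dec_induct)
    case (step n)
    obtain zs where "seq (Suc n) = seq n @ zs" using seq_Suc[OF good] by blast
    with step show ?case by (auto simp: nth_append)
  qed simp
  \<comment> \<open>The lists extend one another and list \<open>n\<close> has more than
    \<open>n\<close> entries, so the diagonal is their limit.\<close>
  define \<tau> where "\<tau> n = Some (seq n ! n)" for n
  have "run p0 \<tau> (kick b) n = run p0 (list_trace (seq n)) (kick b) n" for n
  proof (rule run_cong)
    fix k assume "k < n"
    then show "list_trace (seq n) k = \<tau> k"
      using pre[of k n k] len[of k] by (simp add: \<tau>_def list_trace_def)
  qed simp
  then have never: "run p0 \<tau> (kick b) n \<noteq> base b" for n
    using good[of n] len[of n] by (simp add: good_def)
  have "is_trace \<tau> (spiked (base b))"
  proof -
    have "\<exists>n. \<tau> n = Some x" if x: "x \<in> spiked (base b)" for x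
    proof -
      obtain n where "x = base_enum b n" using x range_base_enum by blast
      then have "x \<in> set (seq (Suc n))" using seq_Suc[OF good, of n] by auto
      then obtain k where k: "k < length (seq (Suc n))" "seq (Suc n) ! k = x"
        by (auto simp: in_set_conv_nth)
      have "seq (max k (Suc n)) ! k = x" "seq (max k (Suc n)) ! k = seq k ! k"
        using pre[of "Suc n" "max k (Suc n)" k] pre[of k "max k (Suc n)" k] k len[of k] by auto
      then show ?thesis by (auto simp: \<tau>_def)
    qed
    moreover have "seq n ! n \<in> spiked (base b)" for n
      using good[of n] len[of n] nth_mem unfolding good_def by blast
    ultimately show ?thesis
      by (auto simp: is_trace_def SMPL_def \<tau>_def)
  qed
  \<comment> \<open>As \<open>base b\<close> is never conjectured, \<open>kick b\<close> is a
    legitimate verifier throughout, which forces convergence.\<close>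
  then obtain N where "\<forall>n\<ge>N. run p0 \<tau> (kick b) n = base b"
    using run_converges check_ok_kick never by blast
  with never show False by blast
qed

end

lemma spiked_notin_CEGIS: "spiked \<notin> CEGIS"
proof
  assume "spiked \<in> CEGIS"
  then obtain F p0 where "spiked_learner F p0"
    unfolding CEGIS_def spiked_learner_def by blast
  then show False by (rule spiked_learner.inconsistent)
qed

theorem theorem2:
  shows "\<not> (HCEGIS \<subseteq> CEGIS) \<and> \<not> (CEGIS \<subseteq> HCEGIS)"
  using spiked_in_HCEGIS spiked_notin_CEGIS segment_in_CEGIS segment_notin_HCEGIS by blast

end
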